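(* Let $p$ be a prime, $q=p^f$ with $f\ge1$, let $k\mid q-1$, and let $A_k=\{x^k:x\in\mathbb{F}_q^\times\}<\mathbb{F}_q^\times$ satisfy $\mathbb{F}_p(A_k)=\mathbb{F}_q$, with $k\ge3$ and $t=|A_k|=(q-1)/k\ge5$. Then $$r_{A_k+A_k}(c)<\frac t2\qquad\text{for every } c\in\mathbb{F}_q^\times.$$
   Context: For $A\subseteq\mathbb{F}_q$ and $c\in\mathbb{F}_q$, $r_{A+A}(c)=\#\{(x,y)\in A^2: x+y=c\}$ (ordered pairs). $\mathbb{F}_p(A_k)$ denotes the smallest subfield of $\mathbb{F}_q$ containing $A_k$. $A_k$ is the unique subgroup of index $k$ in $\mathbb{F}_q^\times$. *)

theory Defs
  imports
    Complex_Main
    "HOL-Library.Cardinality"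
    "HOL-Algebra.Generated_Fields"
    "HOL-Algebra.Algebraic_Closure_Type"
begin

definition kth_powers :: "nat \<Rightarrow> 'a::field set" where
  "kth_powers k = {x ^ k | x. x \<noteq> 0}"

text \<open>
  The subfield generated by \<open>A\<close>. The type-class field is viewed as a HOL-Algebra ring through
  \<^const>\<open>ring_of_type_algebra\<close>, whose carrier is the whole type. The name mentions the prime field
  because every subfield contains it: for a finite field of characteristic \<open>p\<close> this is
  \<open>F_p(A)\<close>.
\<close>
definition prime_field_adjoin :: "'a::field set \<Rightarrow> 'a set" where
  "prime_field_adjoin A = generate_field ring_of_type_algebra A"

lemma prime_field_adjoin_smallest:
  fixes A :: "'a::field set"
  shows "subfield (prime_field_adjoin A) ring_of_type_algebra"
    and "A \<subseteq> prime_field_adjoin A"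
    and "subfield K ring_of_type_algebra \<Longrightarrow> A \<subseteq> K \<Longrightarrow> prime_field_adjoin A \<subseteq> K"
proof -
  interpret R: Ring.field "ring_of_type_algebra :: 'a ring"
    by (rule field_from_type_algebra)
  have A: "A \<subseteq> carrier (ring_of_type_algebra :: 'a ring)"
    by (simp add: ring_of_type_algebra_def)
  show "subfield (prime_field_adjoin A) ring_of_type_algebra"
    unfolding prime_field_adjoin_def by (rule R.generate_field_is_subfield[OF A])
  show "A \<subseteq> prime_field_adjoin A"
    unfolding prime_field_adjoin_def by (blast intro: generate_field.incl)
  show "subfield K ring_of_type_algebra \<Longrightarrow> A \<subseteq> K \<Longrightarrow> prime_field_adjoin A \<subseteq> K"
    unfolding prime_field_adjoin_def by (rule R.generate_field_min_subfield1[OF A])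
qed

definition sum_rep_count :: "'a::field set \<Rightarrow> 'a \<Rightarrow> nat" where
  "sum_rep_count A c = card {(x, y). x \<in> A \<and> y \<in> A \<and> x + y = c}"

end

theory Submission
  imports Defs "HOL-Number_Theory.Residues"
begin

text \<open>
  Let \<open>S\<close> be the set of \<open>x\<close> with \<open>x^t = (c - x)^t = 1\<close>, whose cardinality is the representation
  count. By Stepanov's method, \<open>Q = X^(t+1) + (c - X)^(t+1) - c\<close> vanishes doubly on \<open>S\<close>, which only
  just fails to give \<open>2 |S| < t\<close>: in the critical case \<open>Q\<close> is a constant times a square \<open>g^2\<close>. The
  hypergeometric equation satisfied by \<open>Q\<close> then forces a linear second order equation on \<open>g\<close>,
  and comparing the two shows that \<open>g\<close> divides a nonzero polynomial of degree at most 2, unless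
  one of \<open>2, t - 1, t + 1, 2t + 1\<close> is divisible by \<open>p\<close>.

  In the remaining cases Frobenius provides other relations of low degree on \<open>S\<close>. If
  \<open>j t + 1 = P m\<close> with \<open>P\<close> a power of \<open>p\<close> and \<open>j = 1, 2\<close>, then \<open>x^m\<close> is the \<open>P\<close>-th root of \<open>x\<close>, so
  \<open>x^m + (c - x)^m\<close> is constant on \<open>S\<close>; here \<open>m = 1\<close> would put \<open>A\<close> in the field with \<open>P\<close> elements
  and make its index at most 2. If \<open>t = 1 + p r\<close>, then \<open>1/x^r\<close> is the \<open>p\<close>-th root of \<open>x\<close>, so
  \<open>1/x^r + 1/(c - x)^r\<close> is constant on \<open>S\<close>; for \<open>p = 3\<close> this is again combined with double vanishing.
\<close>

section \<open>Double roots of polynomials and degrees of reflected power sums\<close>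

lemma pderiv_power_of_nat:
  "pderiv (p ^ Suc n) = of_nat (Suc n) * p ^ n * pderiv p"
  by (simp add: pderiv_power_Suc of_nat_poly del: of_nat_Suc power_Suc)

text \<open>Two factors X - s split off at each point; at the other points of S the square (x - s)^2
  is nonzero, so the cofactor inherits both vanishing conditions. Only first derivatives enter, so
  the characteristic may be arbitrary.\<close>

lemma square_prod_linear_dvd:
  fixes p :: "'a::field poly"
  assumes "finite S" "\<And>s. s \<in> S \<Longrightarrow> poly p s = 0" "\<And>s. s \<in> S \<Longrightarrow> poly (pderiv p) s = 0"
  shows "(\<Prod>s\<in>S. [:-s, 1:])\<^sup>2 dvd p"
  using assms
proof (induction S arbitrary: p rule: finite_induct)
  case empty
  then show ?case by simp
next
  case (insert s S)
  obtain r where r: "p = [:-s, 1:] * r"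
    using insert.prems(1)[of s] by (auto simp: poly_eq_0_iff_dvd)
  have "poly (pderiv p) s = poly r s"
    by (simp add: r pderiv_mult pderiv_pCons del: mult_pCons_left)
  then obtain u where u: "r = [:-s, 1:] * u"
    using insert.prems(2)[of s] by (auto simp: poly_eq_0_iff_dvd)
  have p: "p = [:-s, 1:]\<^sup>2 * u"
    by (simp only: r u power2_eq_square mult.assoc)
  have "(\<Prod>s\<in>S. [:-s, 1:])\<^sup>2 dvd u"
  proof (rule insert.IH)
    fix x assume x: "x \<in> S"
    have ne: "x \<noteq> s" using x insert.hyps by auto
    show *: "poly u x = 0"
      using insert.prems(1)[of x] x ne by (auto simp: p)
    show "poly (pderiv u) x = 0"
      using insert.prems(2)[of x] x ne * by (auto simp: p pderiv_mult)
  qed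
  then show ?case
    using insert.hyps by (simp add: power_mult_distrib p mult_dvd_mono del: mult_pCons_left)
qed

lemma degree_prod_linear: "degree (\<Prod>s\<in>S. [:-s, 1:] :: 'a::field poly) = card S"
  by (subst degree_prod_eq_sum_degree) auto

lemma double_roots_le_degree:
  fixes p :: "'a::field poly"
  assumes "finite S" "\<And>s. s \<in> S \<Longrightarrow> poly p s = 0" "\<And>s. s \<in> S \<Longrightarrow> poly (pderiv p) s = 0"
    and "p \<noteq> 0"
  shows "2 * card S \<le> degree p"
proof -
  have "degree ((\<Prod>s\<in>S. [:-s, 1:])\<^sup>2) \<le> degree p"
    using square_prod_linear_dvd[OF assms(1-3)] assms(4) by (rule dvd_imp_degree_le)
  then show ?thesis
    using assms(1) by (subst (asm) degree_power_eq) (simp_all add: degree_prod_linear)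
qed

lemma roots_le_degree:
  fixes p :: "'a::field poly"
  assumes "\<And>s. s \<in> S \<Longrightarrow> poly p s = 0" "p \<noteq> 0"
  shows "card S \<le> degree p"
proof -
  have "card S \<le> card {x. poly p x = 0}"
    by (rule card_mono) (use assms in \<open>auto simp: poly_roots_finite\<close>)
  then show ?thesis
    using card_poly_roots_bound[OF assms(2)] by linarith
qed

lemma degree_power_linear: "degree ([:a, b:] ^ n :: 'a::field poly) \<le> n"
  using degree_power_le[of "[:a, b:]" n] by (auto split: if_splits)

lemma degree_sum_reflected_powers:
  fixes c :: "'a::field"
  shows "degree ([:0, 1:] ^ n + [:c, -1:] ^ n) \<le> n"
  by (intro degree_add_le degree_power_linear)

text \<open>The leading coefficients 1 and (-1)^n cancel. This one degree makes several later bounds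
  strict.\<close>

lemma degree_sum_reflected_powers_odd:
  fixes c :: "'a::field"
  assumes "odd n"
  shows "degree ([:0, 1:] ^ n + [:c, -1:] ^ n) \<le> n - 1"
proof -
  have "coeff ([:0, 1::'a:] ^ n) n = 1" "coeff ([:c, -1:] ^ n) n = (-1) ^ n"
    using lead_coeff_power[of "[:0, 1::'a:]" n] lead_coeff_power[of "[:c, -1:]" n]
    by (simp_all add: degree_power_eq)
  then have "coeff ([:0, 1:] ^ n + [:c, -1:] ^ n) n = 0"
    using assms by simp
  moreover have "n > 0" using assms odd_pos by auto
  ultimately show ?thesis
    using degree_sum_reflected_powers[of n c]
    by (metis (no_types, lifting) degree_0 diff_Suc_1 le_Suc_eq leading_coeff_0_iff le_0_eq
        not0_implies_Suc not_gr_zero zero_le)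
qed

section \<open>Frobenius and elements fixed by the power P m\<close>

lemma frobenius_diff:
  fixes x y :: "'a::field"
  assumes "prime CHAR('a)" "P = CHAR('a) ^ e"
  shows "(x - y) ^ P = x ^ P - y ^ P"
  using freshmans_dream'[OF assms, of "x - y" y] by (simp add: algebra_simps)

lemma frobenius_inj:
  fixes x y :: "'a::field"
  assumes "prime CHAR('a)" "P = CHAR('a) ^ e" "x ^ P = y ^ P"
  shows "x = y"
  using frobenius_diff[OF assms(1,2), of x y] assms(3) by simp

text \<open>On S the P-th power of \<open>x ^ m + (c - x) ^ m\<close> is c. Frobenius is injective,
  so the sum is a constant d there and S consists of roots of a polynomial of degree at most
  m.\<close>

lemma card_power_fixed_le:
  fixes c :: "'a::field"
  assumes ch: "prime CHAR('a)" "P = CHAR('a) ^ e" and m: "m \<ge> 2" "of_nat m \<noteq> (0::'a)"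
    and c: "c \<noteq> 0"
    and S: "\<And>x. x \<in> S \<Longrightarrow> x ^ (P * m) = x \<and> (c - x) ^ (P * m) = c - x"
  shows "card S \<le> m" and "odd m \<Longrightarrow> card S \<le> m - 1"
proof -
  have "card S \<le> m \<and> (odd m \<longrightarrow> card S \<le> m - 1)"
  proof (cases "S = {}")
    case False
    then obtain x0 where x0: "x0 \<in> S" by auto
    define d where "d = x0 ^ m + (c - x0) ^ m"
    have frob: "(x ^ m + (c - x) ^ m) ^ P = c" if "x \<in> S" for x
      using S[OF that] by (simp add: freshmans_dream'[OF ch] mult.commute flip: power_mult)
    have root: "x ^ m + (c - x) ^ m = d" if "x \<in> S" for x
      by (rule frobenius_inj[OF ch]) (simp only: d_def frob[OF that] frob[OF x0])
    define R where "R = ([:0, 1:] ^ m + [:c, -1:] ^ m) - [:d:]"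
    obtain n where n: "m = Suc n" "n > 0"
      using m(1) by (cases m) auto
    \<comment> \<open>The derivative is m (X^n - (c - X)^n), and n > 0 kills the first term at 0.
      For m = 1 the sum would be identically c and bound nothing.\<close>
    have "poly (pderiv R) 0 = - of_nat m * c ^ n"
      using n(2) by (simp add: R_def n(1) pderiv_diff pderiv_add pderiv_power_of_nat pderiv_pCons
          del: of_nat_Suc power_Suc)
    then have "R \<noteq> 0" using m(2) c by auto
    moreover have "poly R x = 0" if "x \<in> S" for x
      using root[OF that] by (simp add: R_def)
    ultimately have "card S \<le> degree R" by (rule roots_le_degree[rotated])
    moreover have "degree R \<le> m"
      unfolding R_def by (rule degree_diff_le[OF degree_sum_reflected_powers]) simp
    moreover have "degree R \<le> m - 1" if "odd m"
      unfolding R_def by (rule degree_diff_le[OF degree_sum_reflected_powers_odd[OF that]]) simp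
    ultimately show ?thesis by auto
  qed simp
  then show "card S \<le> m" and "odd m \<Longrightarrow> card S \<le> m - 1" by auto
qed

section \<open>k-th powers in a finite field and the subfield they generate\<close>

lemma finite_field_power_card:
  fixes x :: "'a::{field, finite}"
  assumes "x \<noteq> 0"
  shows "x ^ (CARD('a) - 1) = 1"
proof -
  have "(\<Prod>y\<in>UNIV-{0}. x * y) = x ^ (CARD('a) - 1) * \<Prod>(UNIV-{0})"
    by (simp add: prod.distrib)
  moreover have "(\<Prod>y\<in>UNIV-{0}. x * y) = (\<Prod>y\<in>UNIV-{0}. y)"
    by (rule prod.reindex_bij_witness[of _ "\<lambda>y. y / x" "\<lambda>y. x * y"]) (use assms in auto)
  ultimately show ?thesis
    by simp
qed

lemma card_power_eq_le:
  fixes a :: "'a::field"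
  assumes "n > 0"
  shows "card {x. x ^ n = a} \<le> n"
proof -
  let ?p = "[:0, 1:] ^ n - [:a:]"
  have "degree ([:0, 1::'a:] ^ n) = n"
    by (simp add: degree_power_eq)
  then have "?p \<noteq> 0" using assms
    by (metis degree_pCons_0 eq_iff_diff_eq_0 less_numeral_extra(3))
  then have "card {x. x ^ n = a} \<le> degree ?p"
    by (rule roots_le_degree[rotated]) auto
  also have "\<dots> \<le> n"
    by (intro degree_diff_le degree_power_linear) auto
  finally show ?thesis .
qed

text \<open>Counting replaces cyclicity: A lies among the at most s roots of x^s = 1, while the
  fibres of x -> x^k have at most k elements and cover k s nonzero elements, so A has at least s
  elements.\<close>

lemma kth_powers_eq:
  fixes A :: "'a::{field, finite} set"
  assumes A: "A = kth_powers k" and k: "k dvd CARD('a) - 1" "k > 0"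
  shows "k * card A = CARD('a) - 1" and "A = {x. x ^ card A = 1}"
proof -
  obtain s where s: "CARD('a) - 1 = k * s" using k(1) by blast
  have "card {0, 1::'a} \<le> CARD('a)" by (rule card_mono) auto
  then have q: "CARD('a) \<ge> 2" by simp
  then have s0: "s > 0" using s by (cases s) auto
  have sub: "A \<subseteq> {x. x ^ s = 1}"
    using finite_field_power_card[where ?'a = 'a, unfolded s]
    by (auto simp: A kth_powers_def simp flip: power_mult)
  then have le: "card A \<le> card {x::'a. x ^ s = 1}" by (intro card_mono) auto
  have les: "card {x::'a. x ^ s = 1} \<le> s" by (rule card_power_eq_le[OF s0])
  have "UNIV - {0::'a} \<subseteq> (\<Union>a\<in>A. {x. x ^ k = a})"
    by (auto simp: A kth_powers_def)
  then have "card (UNIV - {0::'a}) \<le> card (\<Union>a\<in>A. {x. x ^ k = a})"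
    by (intro card_mono) auto
  also have "\<dots> \<le> (\<Sum>a\<in>A. card {x. x ^ k = a})"
    by (rule card_UN_le) auto
  also have "\<dots> \<le> (\<Sum>a\<in>A. k)"
    by (intro sum_mono card_power_eq_le k(2))
  finally have "k * s \<le> k * card A"
    using s by (simp add: card_Diff_subset mult.commute)
  then have "s \<le> card A" using k(2) by simp
  then have eq: "card A = s" using le les by simp
  then show "k * card A = CARD('a) - 1" using s by simp
  show "A = {x. x ^ card A = 1}"
    unfolding eq by (rule card_subset_eq) (use sub eq le les in auto)
qed

lemma subfield_frobenius_fixed:
  assumes ch: "prime CHAR('a::field)" "P = CHAR('a) ^ e"
  shows "subfield {x::'a. x ^ P = x} ring_of_type_algebra"
proof -
  let ?R = "ring_of_type_algebra :: 'a ring" and ?K = "{x::'a. x ^ P = x}"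
  interpret R: Ring.field ?R
    by (rule field_from_type_algebra)
  have P: "P > 0" using ch by (simp add: prime_gt_0_nat)
  have neg: "(- x) ^ P = - (x ^ P)" for x :: 'a
    using frobenius_diff[OF ch, of 0 x] P by simp
  have add_ring: "x \<oplus>\<^bsub>?R\<^esub> y = x + y"
    and mult_ring: "x \<otimes>\<^bsub>?R\<^esub> y = x * y" and zero_ring: "\<zero>\<^bsub>?R\<^esub> = 0"
    and one_ring: "\<one>\<^bsub>?R\<^esub> = 1"
    and carrier_ring: "carrier ?R = UNIV" for x y
    by (simp_all add: ring_of_type_algebra_def)
  have inv_add: "\<ominus>\<^bsub>?R\<^esub> x = - x" for x
    by (rule sym, rule R.sum_zero_eq_neg) (simp_all add: carrier_ring add_ring zero_ring)
  have inv_mult: "inv\<^bsub>?R\<^esub> x = inverse x" if "x \<noteq> 0" for x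
    by (rule R.comm_inv_char) (use that in \<open>simp_all add: carrier_ring mult_ring one_ring\<close>)
  show ?thesis
  proof (rule R.subfieldI'[OF R.subringI])
    fix h1 h2 assume "h1 \<in> ?K" "h2 \<in> ?K"
    then show "h1 \<otimes>\<^bsub>?R\<^esub> h2 \<in> ?K" "h1 \<oplus>\<^bsub>?R\<^esub> h2 \<in> ?K"
      by (auto simp: mult_ring add_ring power_mult_distrib freshmans_dream'[OF ch])
  qed (auto simp: carrier_ring one_ring inv_add neg zero_ring inv_mult power_inverse)
qed

text \<open>The fixed points of x -> x^P form a subfield containing A, hence the whole field, and
  they are roots of X^P - X.\<close>

lemma adjoin_eq_UNIV_imp_card_le:
  fixes A :: "'a::{field, finite} set"
  assumes ch: "prime CHAR('a)" "P = CHAR('a) ^ e" and A: "prime_field_adjoin A = UNIV"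
    and fixed: "\<And>x. x \<in> A \<Longrightarrow> x ^ P = x" and "P > 1"
  shows "CARD('a) \<le> P"
proof -
  have "{x::'a. x ^ P = x} = UNIV"
    using prime_field_adjoin_smallest(3)[OF subfield_frobenius_fixed[OF ch], of A] A fixed by auto
  moreover have "card {x::'a. x ^ P = x} \<le> P"
  proof -
    let ?p = "[:0, 1:] ^ P - [:0, 1::'a:]"
    have "degree ([:0, 1::'a:] ^ P) = P" "degree [:0, 1::'a:] = 1"
      by (simp_all add: degree_power_eq)
    then have "?p \<noteq> 0" using \<open>P > 1\<close>
      by (metis eq_iff_diff_eq_0 less_irrefl)
    then have "card {x::'a. x ^ P = x} \<le> degree ?p"
      by (rule roots_le_degree[rotated]) auto
    also have "\<dots> \<le> P"
      using \<open>P > 1\<close> by (intro degree_diff_le degree_power_linear) auto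
    finally show ?thesis .
  qed
  ultimately show ?thesis by simp
qed

section \<open>The case t = 1 mod p, and the refinement in characteristic 3\<close>

lemma reciprocal_sum_const:
  fixes c :: "'a::field"
  assumes ch: "prime CHAR('a)" and t: "t = 1 + CHAR('a) * r" and c: "c \<noteq> 0"
    and S: "\<And>x. x \<in> S \<Longrightarrow> x ^ t = 1 \<and> (c - x) ^ t = 1" and ne: "S \<noteq> {}"
  obtains d where "d \<noteq> 0"
    "\<And>x. x \<in> S \<Longrightarrow> x ^ r + (c - x) ^ r = d * x ^ r * (c - x) ^ r"
proof -
  let ?p = "CHAR('a)"
  have ch': "?p = ?p ^ 1" by simp
  have inv: "inverse (x ^ r) ^ ?p = x" if "x ^ t = 1" for x :: 'a
  proof -
    have "x * (x ^ r) ^ ?p = 1"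
      using that by (simp add: t mult.commute flip: power_mult)
    then show ?thesis
      by (metis inverse_unique mult.commute power_inverse)
  qed
  have frob: "(inverse (x ^ r) + inverse ((c - x) ^ r)) ^ ?p = c" if "x \<in> S" for x
    using S[OF that] by (simp add: freshmans_dream'[OF ch ch'] inv)
  obtain x0 where x0: "x0 \<in> S" using ne by auto
  define d where "d = inverse (x0 ^ r) + inverse ((c - x0) ^ r)"
  have d: "inverse (x ^ r) + inverse ((c - x) ^ r) = d" if "x \<in> S" for x
    by (rule frobenius_inj[OF ch ch']) (simp only: d_def frob[OF that] frob[OF x0])
  show thesis
  proof
    \<comment> \<open>The p-th power of d is c.\<close>
    show "d \<noteq> 0" using frob[OF x0] c ch by (auto simp: d_def[symmetric] prime_gt_0_nat)
    fix x assume x: "x \<in> S"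
    have "x ^ r \<noteq> 0" "(c - x) ^ r \<noteq> 0"
      using S[OF x] by (auto simp: t)
    then show "x ^ r + (c - x) ^ r = d * x ^ r * (c - x) ^ r"
      by (simp add: d[OF x, symmetric] field_simps)
  qed
qed

text \<open>Clearing denominators in the reciprocal relation leaves a polynomial of degree at most
  2r with value c^r at 0.\<close>

lemma card_le_of_mod_CHAR_eq_1:
  fixes c :: "'a::field"
  assumes ch: "prime CHAR('a)" and t: "t = 1 + CHAR('a) * r" and c: "c \<noteq> 0" and r: "r > 0"
    and S: "\<And>x. x \<in> S \<Longrightarrow> x ^ t = 1 \<and> (c - x) ^ t = 1"
  shows "card S \<le> 2 * r"
proof (cases "S = {}")
  case False
  obtain d where d: "d \<noteq> 0"
    "\<And>x. x \<in> S \<Longrightarrow> x ^ r + (c - x) ^ r = d * x ^ r * (c - x) ^ r"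
    using reciprocal_sum_const[OF ch t c S False] by blast
  define a b where "a = [:0, 1::'a:] ^ r" and "b = [:c, -1:] ^ r"
  define R where "R = a + b - smult d (a * b)"
  have "poly R 0 \<noteq> 0" using c r by (simp add: R_def a_def b_def power_0_left)
  then have "R \<noteq> 0" by auto
  then have "card S \<le> degree R"
    by (rule roots_le_degree[rotated]) (use d(2) in \<open>simp add: R_def a_def b_def\<close>)
  also have "degree a \<le> r" "degree b \<le> r"
    unfolding a_def b_def by (rule degree_power_linear)+
  then have "degree (a * b) \<le> 2 * r"
    using degree_mult_le[of a b] by linarith
  then have "degree R \<le> 2 * r"
    unfolding R_def using degree_sum_reflected_powers[of r c]
    by (intro degree_diff_le) (auto simp: a_def b_def intro: order.trans[OF degree_smult_le])
  finally show ?thesis .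
qed simp

text \<open>The bound 2r is too weak here because 4r >= t. Two relations on S are therefore combined
  into one polynomial of degree at most 3r = t - 1 with double zeros on S.\<close>

lemma card_lt_of_CHAR_3:
  fixes c :: "'a::field"
  assumes ch: "CHAR('a) = 3" and t: "t = 1 + 3 * r" and c: "c \<noteq> 0" and r: "r > 0"
    and m: "of_nat (2 * r + 1) \<noteq> (0::'a)"
    and S: "\<And>x. x \<in> S \<Longrightarrow> x ^ t = 1 \<and> (c - x) ^ t = 1" and fin: "finite S"
  shows "2 * card S < t"
proof (cases "S = {}")
  case False
  have prime: "prime CHAR('a)" using ch by simp
  have t': "t = 1 + CHAR('a) * r" using t ch by simp
  obtain d where d: "d \<noteq> 0"
    "\<And>x. x \<in> S \<Longrightarrow> x ^ r + (c - x) ^ r = d * x ^ r * (c - x) ^ r"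
    using reciprocal_sum_const[OF prime t' c S False] by blast
  obtain n where n: "r = Suc n" using r by (cases r) auto
  define \<rho> :: 'a where "\<rho> = of_nat r"
  have three: "(3::'a) = 0"
    using ch of_nat_CHAR[where ?'a = 'a] by simp
  define a b where "a = [:0, 1::'a:] ^ r" and "b = [:c, -1:] ^ r"
  define R1 where "R1 = a + b - smult d (a * b)"
  \<comment> \<open>The same relation with reciprocals written differently: x^t = 1 gives 1/x^r = x
    (x^r)^2 = x^(2r+1).\<close>
  define R2 where "R2 = [:0, 1:] * a\<^sup>2 + [:c, -1:] * b\<^sup>2 - [:d:]"
  \<comment> \<open>\<open>R1\<close> and \<open>R2\<close> vanish on \<open>S\<close>, and their derivatives there are proportional with ratio
    \<open>- \<rho> (a + b) : (1 + 2 \<rho>) d\<close>; so the combination \<open>W\<close> vanishes doubly.\<close>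
  define W where "W = smult ((1 + 2 * \<rho>) * d) R1 + smult \<rho> ((a + b) * R2)"
  have polys: "poly a x = x ^ r" "poly b x = (c - x) ^ r"
    "poly (pderiv a) x = \<rho> * x ^ n" "poly (pderiv b) x = - \<rho> * (c - x) ^ n" for x
    by (simp_all add: a_def b_def \<rho>_def n pderiv_power_of_nat pderiv_pCons
      del: power_Suc of_nat_Suc)
  have "2 * card S \<le> degree W"
  proof (rule double_roots_le_degree[OF fin])
    fix s assume s: "s \<in> S"
    define \<alpha> \<beta> u v where "\<alpha> = s ^ r" and "\<beta> = (c - s) ^ r" and "u = s ^ n" and "v = (c - s) ^ n"
    have e1: "\<alpha> + \<beta> = d * \<alpha> * \<beta>" using d(2)[OF s] by (simp add: \<alpha>_def \<beta>_def)
    have e2: "s * \<alpha> ^ 3 = 1" "(c - s) * \<beta> ^ 3 = 1"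
      using S[OF s] by (simp_all add: \<alpha>_def \<beta>_def t mult.commute flip: power_mult)
    have e3: "\<alpha> = s * u" "\<beta> = (c - s) * v" by (simp_all add: \<alpha>_def \<beta>_def u_def v_def n)
    \<comment> \<open>This removes s and r from the derivatives, leaving polynomials in \<alpha>,
      \<beta>, d and \<rho>.\<close>
    have u: "u = \<alpha> ^ 4" "v = \<beta> ^ 4"
    proof -
      have "\<alpha> ^ 4 = u * (s * \<alpha> ^ 3)" "\<beta> ^ 4 = v * ((c - s) * \<beta> ^ 3)"
        by (simp_all add: e3 eval_nat_numeral mult_ac)
      then show "u = \<alpha> ^ 4" "v = \<beta> ^ 4" using e2 by simp_all
    qed
    have nz: "\<alpha> \<noteq> 0" "\<beta> \<noteq> 0" using e2 by auto
    have e4: "s * \<alpha>\<^sup>2 + (c - s) * \<beta>\<^sup>2 = d"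
    proof -
      have "\<alpha> * \<beta> * (s * \<alpha>\<^sup>2 + (c - s) * \<beta>\<^sup>2) = s * \<alpha> ^ 3 * \<beta> + (c - s) * \<beta> ^ 3 * \<alpha>"
        by (simp add: eval_nat_numeral algebra_simps)
      also have "\<dots> = \<alpha> * \<beta> * d" using e1 by (simp add: e2 mult_ac add_ac)
      finally have "\<alpha> * \<beta> * (s * \<alpha>\<^sup>2 + (c - s) * \<beta>\<^sup>2) = \<alpha> * \<beta> * d" .
      then show ?thesis using nz by simp
    qed
    have p1: "poly R1 s = 0"
      using e1 by (simp add: R1_def polys \<alpha>_def \<beta>_def)
    have p2: "poly R2 s = 0"
      using e4 by (simp add: R2_def polys \<alpha>_def \<beta>_def algebra_simps)
    show "poly W s = 0" by (simp add: W_def p1 p2)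
    have q1: "poly (pderiv R1) s = \<rho> * (u - v - d * (u * \<beta> - \<alpha> * v))"
      by (simp add: R1_def pderiv_add pderiv_diff pderiv_smult pderiv_mult polys algebra_simps
          \<alpha>_def \<beta>_def u_def v_def)
    have q2: "poly (pderiv R2) s = \<alpha>\<^sup>2 + 2 * \<rho> * s * \<alpha> * u - \<beta>\<^sup>2 - 2 * \<rho> * (c - s) * \<beta> * v"
      unfolding R2_def pderiv_add pderiv_diff pderiv_mult power2_eq_square
      by (simp add: pderiv_pCons polys algebra_simps \<alpha>_def \<beta>_def u_def v_def)
    have q2': "poly (pderiv R2) s = (1 + 2 * \<rho>) * (\<alpha>\<^sup>2 - \<beta>\<^sup>2)"
      unfolding q2 e3 by (simp add: algebra_simps power2_eq_square)
    have "poly (pderiv W) s = (1 + 2 * \<rho>) * d * (\<rho> * (u - v - d * (u * \<beta> - \<alpha> * v)))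
        + \<rho> * ((\<alpha> + \<beta>) * ((1 + 2 * \<rho>) * (\<alpha>\<^sup>2 - \<beta>\<^sup>2)))"
      by (simp add: W_def pderiv_add pderiv_smult pderiv_mult p2 q1 q2' polys \<alpha>_def \<beta>_def)
    \<comment> \<open>The last factor is the relation \<open>e1\<close>.\<close>
    also have "\<dots> = (1 + 2 * \<rho>) * \<rho> * (d * (\<alpha> ^ 3 - \<beta> ^ 3) + \<alpha>\<^sup>2 - \<beta>\<^sup>2) * (\<alpha> + \<beta> - d * \<alpha> * \<beta>)"
      unfolding u by (simp add: eval_nat_numeral algebra_simps)
    also have "\<dots> = 0" using e1 by simp
    finally show "poly (pderiv W) s = 0" .
  next
    have W0: "poly W 0 = c ^ r * ((1 + 2 * \<rho>) * d + \<rho> * (c * (c ^ r)\<^sup>2 - d))"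
      using r by (simp add: W_def R1_def R2_def polys power_0_left algebra_simps)
    \<comment> \<open>The hypothesis on 2r + 1 leaves \<rho> = 0 or -1, where the bracket in
      \<open>W0\<close> is d or -c^(2r+1).\<close>
    have "\<rho> * (\<rho> + 1) * (2 * \<rho> + 1) = 0"
    proof -
      have "3 dvd r \<or> 3 dvd r + 1 \<or> 3 dvd 2 * r + 1" by presburger
      then have "3 dvd r * (r + 1) * (2 * r + 1)" by (meson dvd_mult dvd_mult2)
      then have "of_nat (r * (r + 1) * (2 * r + 1)) = (0::'a)"
        using ch by (simp only: of_nat_eq_0_iff_char_dvd)
      then show ?thesis by (simp only: \<rho>_def of_nat_mult of_nat_add of_nat_1 of_nat_numeral)
    qed
    moreover have "2 * \<rho> + 1 \<noteq> 0" using m by (simp add: \<rho>_def add.commute)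
    ultimately consider "\<rho> = 0" | "\<rho> = -1"
      by (auto simp: eq_neg_iff_add_eq_0)
    then have "poly W 0 \<noteq> 0"
    proof cases
      case 1
      then show ?thesis using W0 c d(1) by simp
    next
      case 2
      have "(1 + 2 * \<rho>) * d + \<rho> * (c * (c ^ r)\<^sup>2 - d) = - (c * (c ^ r)\<^sup>2)"
        by (simp add: 2)
      then show ?thesis using W0 c by simp
    qed
    then show "W \<noteq> 0" by auto
  qed
  also have "degree W \<le> 3 * r"
  proof -
    have ab: "degree a \<le> r" "degree b \<le> r"
      unfolding a_def b_def by (rule degree_power_linear)+
    have "degree (a + b) \<le> r" using ab by (rule degree_add_le)
    have "degree R1 \<le> 2 * r" unfolding R1_def
      using ab degree_mult_le[of a b]
      by (intro degree_diff_le degree_add_le order.trans[OF degree_smult_le]) auto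
    \<comment> \<open>The odd exponent 2r + 1 lowers the degree of \<open>R2\<close> to 2r;
      otherwise the bound for W would be t and strictness would be lost.\<close>
    have "R2 = ([:0, 1:] ^ (2 * r + 1) + [:c, -1:] ^ (2 * r + 1)) - [:d:]"
      by (simp add: R2_def a_def b_def power_mult mult.commute flip: power_mult)
    then have "degree R2 \<le> 2 * r"
      using degree_sum_reflected_powers_odd[of "2 * r + 1" c]
      by (auto intro!: degree_diff_le)
    then have "degree ((a + b) * R2) \<le> 3 * r"
      using degree_mult_le[of "a + b" R2] \<open>degree (a + b) \<le> r\<close> by linarith
    then show ?thesis unfolding W_def
      using \<open>degree R1 \<le> 2 * r\<close> by (intro degree_add_le order.trans[OF degree_smult_le]) auto
  qed
  finally show ?thesis using t by simp
qed (use t in simp)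

section \<open>The generic case: the hypergeometric equation and its square solutions\<close>

text \<open>Z^(t+1) and (C - Z)^(t+1) each solve the homogeneous equation, and Q + C is their
  sum.\<close>

lemma reflected_power_ODE:
  fixes c :: "'a::field"
  defines "Z \<equiv> [:0, 1:] :: 'a poly" and "C \<equiv> [:c:]"
  assumes t: "t \<ge> 1" and Q: "Q = Z ^ (t + 1) + (C - Z) ^ (t + 1) - C"
  shows "Z * (C - Z) * pderiv (pderiv Q) + of_nat t * (2 * Z - C) * pderiv Q
    = of_nat t * (of_nat t + 1) * (Q + C)"
proof -
  obtain n where n: "t = Suc n" using t by (cases t) auto
  have dZ: "pderiv Z = 1" and dC: "pderiv C = 0" by (simp_all add: Z_def C_def pderiv_pCons)
  define \<tau> :: "'a poly" where "\<tau> = of_nat (Suc n)"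
  have d\<tau>: "pderiv \<tau> = 0" unfolding \<tau>_def by (rule pderiv_of_nat)
  have \<tau>1: "of_nat (Suc (Suc n)) = \<tau> + 1" by (simp add: \<tau>_def)
  define U V where "U = Z ^ n" and "V = (C - Z) ^ n"
  have Q': "Q = Z ^ Suc (Suc n) + (C - Z) ^ Suc (Suc n) - C" using Q n by simp
  have Q0: "Q = Z * Z * U + (C - Z) * (C - Z) * V - C"
    unfolding Q' U_def V_def by (simp add: mult.assoc)
  have Q1: "pderiv Q = (\<tau> + 1) * (Z ^ Suc n - (C - Z) ^ Suc n)"
    unfolding Q' pderiv_diff pderiv_add pderiv_power_of_nat dZ dC \<tau>1 by (simp add: algebra_simps)
  then have Q1': "pderiv Q = (\<tau> + 1) * (Z * U - (C - Z) * V)"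
    by (simp add: U_def V_def)
  have Q2: "pderiv (pderiv Q) = (\<tau> + 1) * (\<tau> * (U + V))"
    unfolding Q1 pderiv_diff pderiv_add pderiv_mult pderiv_power_of_nat dZ dC d\<tau> U_def V_def
      \<tau>_def[symmetric]
    by (simp add: algebra_simps)
  show ?thesis
    unfolding Q2 unfolding Q1'
    unfolding Q0 n \<tau>_def[symmetric] by (simp add: algebra_simps)
qed

lemma degree_pderiv_le: "degree (pderiv p) \<le> degree p - 1"
  by (rule degree_le) (auto simp: coeff_pderiv coeff_eq_0)

text \<open>Reduction modulo g yields a linear equation \<open>L = g * M\<close> with M constant;
  differentiating a quadratic first integral yields another, \<open>fourth\<close>. Eliminating k
  makes g divide H, which has degree at most 2 and is nonzero at 0.\<close>

lemma no_square_of_ODE: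
  fixes g :: "'a::field poly" and c \<kappa> \<tau> :: 'a
  defines "Z \<equiv> [:0, 1:] :: 'a poly" and "C \<equiv> [:c:]" and "K \<equiv> [:\<kappa>:]" and "T \<equiv> [:\<tau>:]"
  assumes ode: "\<And>Q. Q = K * g\<^sup>2 \<Longrightarrow>
      Z * (C - Z) * pderiv (pderiv Q) + T * (2 * Z - C) * pderiv Q = T * (T + 1) * (Q + C)"
    and deg: "degree g > 2" and nz: "\<kappa> \<noteq> 0" "c \<noteq> 0" "\<tau> \<noteq> 0" "\<tau> + 1 \<noteq> 0"
    "\<tau> - 1 \<noteq> 0" "2 * \<tau> + 1 \<noteq> 0" "(2::'a) \<noteq> 0"
  shows False
proof -
  have dZ: "pderiv Z = 1" and dC: "pderiv C = 0" and dK: "pderiv K = 0" and dT: "pderiv T = 0"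
    by (simp_all add: Z_def C_def K_def T_def pderiv_pCons)
  have numerals: "pderiv (numeral n :: 'a poly) = 0" for n
    using pderiv_of_nat[of "numeral n"] by simp
  note pderivs = dZ dC dK dT numerals pderiv_mult pderiv_add pderiv_diff pderiv_1
  \<comment> \<open>In terms of \<open>y = Y/c\<close> one has \<open>4 D = c^2 (1 - y^2)\<close>.\<close>
  define D Y where "D = Z * (C - Z)" and "Y = 2 * Z - C"
  have dD: "pderiv D = - Y" and dY: "pderiv Y = 2"
    by (simp_all add: D_def Y_def pderivs)
  define h k where "h = pderiv g" and "k = pderiv h"
  have Kne: "K \<noteq> 0" using nz by (auto simp: K_def)
  define E where "E = T * (T + 1) * C"
  have E: "E = [:\<tau> * (\<tau> + 1) * c:]"
  proof -
    have "T + 1 = [:\<tau> + 1:]" by (simp only: T_def one_pCons add_pCons add_0_right)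
    then show ?thesis by (simp add: E_def T_def C_def)
  qed
  have Eu: "E dvd 1"
    unfolding E using nz by (simp add: is_unit_const_poly_iff dvd_field_iff)
  have dE: "pderiv E = 0" unfolding E by simp
  have g2: "pderiv (K * g\<^sup>2) = 2 * K * g * h"
    by (simp add: power2_eq_square pderivs h_def algebra_simps)
  have g3: "pderiv (2 * K * g * h) = 2 * K * (h\<^sup>2 + g * k)"
    by (simp add: power2_eq_square pderivs h_def k_def algebra_simps)
  have ode1: "D * (2 * K * (h\<^sup>2 + g * k)) + T * Y * (2 * K * g * h) = T * (T + 1) * (K * g\<^sup>2 + C)"
    using ode[OF refl] unfolding g2 g3 D_def Y_def .
  define w where "w = T * (T + 1) * K * g - 2 * K * T * Y * h - 2 * K * D * k"
  have first: "2 * K * D * h\<^sup>2 - E = g * w"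
  proof -
    have "2 * K * D * h\<^sup>2 - E - g * w = D * (2 * K * (h\<^sup>2 + g * k)) + T * Y * (2 * K * g * h)
        - T * (T + 1) * (K * g\<^sup>2 + C)"
      by (simp add: w_def E_def algebra_simps power2_eq_square)
    then show ?thesis using ode1 by simp
  qed
  then have E': "E = 2 * K * D * h\<^sup>2 - g * w" by (simp add: algebra_simps)
  \<comment> \<open>By \<open>first\<close>, \<open>g\<close> is coprime to its derivative \<open>h\<close>, because \<open>E\<close> is a unit.\<close>
  have cancel: "g dvd r" if "g dvd h * r" for r
  proof -
    have "E * r = 2 * K * D * h * (h * r) - g * (w * r)"
      by (simp add: E' algebra_simps power2_eq_square)
    then have "g dvd E * r" using that by (simp add: dvd_diff dvd_mult)
    then show ?thesis
      using Eu by (simp add: dvd_mult_unit_iff')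
  qed
  have "pderiv (2 * K * D * h\<^sup>2 - E) = pderiv (g * w)" using first by simp
  then have second: "- 2 * K * Y * h\<^sup>2 + 4 * K * D * h * k = h * w + g * pderiv w"
    by (simp add: power2_eq_square pderivs dE dD h_def[symmetric] k_def[symmetric] algebra_simps)
  have const_mult: "degree (u * v) = 0" if "degree u = 0" "degree v = 0" for u v :: "'a poly"
    using degree_mult_le[of u v] that by simp
  have const_diff: "degree (u - v) = 0" if "degree u = 0" "degree v = 0" for u v :: "'a poly"
    using degree_diff_le[of u 0 v] that by simp
  have const_add: "degree (u + v) = 0" if "degree u = 0" "degree v = 0" for u v :: "'a poly"
    using degree_add_le[of u 0 v] that by simp
  have "degree T = 0" by (simp add: T_def)
  then have degT: "degree T = 0" "degree (T - 1) = 0" "degree (T + 1) = 0" "degree (4 * T + 2) = 0"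
    by (auto intro!: const_mult const_diff const_add)
  \<comment> \<open>Modulo g, w is -2K (T Y h + D k); inserting this in \<open>second\<close> gives
    h * 2K L = 0 modulo g.\<close>
  define L where "L = 3 * D * k + (T - 1) * Y * h"
  have "h * (2 * K * L) = g * (pderiv w + T * (T + 1) * K * h)"
  proof -
    have "h * (2 * K * L) - g * (pderiv w + T * (T + 1) * K * h)
        = - 2 * K * Y * h\<^sup>2 + 4 * K * D * h * k - (h * w + g * pderiv w)"
      by (subst (2) w_def) (simp add: L_def algebra_simps power2_eq_square)
    then show ?thesis using second by simp
  qed
  then have "g dvd 2 * K * L" using cancel[of "2 * K * L"] by (simp only: dvd_triv_left)
  moreover have "2 * K * L = smult (2 * \<kappa>) L"
    by (simp add: K_def numeral_poly mult.commute)
  ultimately have gL: "g dvd L" using nz by (simp add: dvd_smult_iff)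
  have degh: "degree h \<le> degree g - 1" unfolding h_def by (rule degree_pderiv_le)
  have degk: "degree k \<le> degree g - 2" unfolding k_def using degree_pderiv_le[of h] degh by simp
  have degD: "degree D \<le> 2"
    unfolding D_def Z_def C_def by simp
  have degY: "degree Y \<le> 1"
    unfolding Y_def Z_def C_def by (simp add: numeral_poly)
  have "degree L \<le> degree g"
  proof -
    have "degree (3 * D * k) \<le> degree g"
      using degree_mult_le[of "3 * D" k] degree_mult_le[of 3 D] degD degk deg by simp
    moreover have "degree ((T - 1) * Y * h) \<le> degree g"
      using degree_mult_le[of "(T - 1) * Y" h] degree_mult_le[of "T - 1" Y] degY degh deg
      by (simp add: degT)
    ultimately show ?thesis unfolding L_def by (rule degree_add_le)
  qed
  obtain M where M: "L = g * M" using gL by blast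
  have gne: "g \<noteq> 0" using deg by auto
  have "degree M = 0"
    using \<open>degree L \<le> degree g\<close> gne M degree_mult_eq[of g M] by (cases "M = 0") auto
  then have dM: "pderiv M = 0" by (auto elim!: degree_eq_zeroE)
  \<comment> \<open>Removing 3 D k from \<open>first\<close> by means of L = g M leaves a quadratic
    form in g and h with constant value.\<close>
  have third: "K * (6 * D * h\<^sup>2 + (4 * T + 2) * Y * g * h - (3 * T * (T + 1) - 2 * M) * g\<^sup>2) = 3 * E"
  proof -
    have "K * (6 * D * h\<^sup>2 + (4 * T + 2) * Y * g * h - (3 * T * (T + 1) - 2 * M) * g\<^sup>2) - 3 * E
        = 3 * (2 * K * D * h\<^sup>2 - E - g * w) + 2 * K * g * (g * M - L)"
      by (simp add: w_def L_def algebra_simps power2_eq_square)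
    then show ?thesis using first M by simp
  qed
  \<comment> \<open>Differentiate \<open>third\<close> and replace 3 D k again: the Y h^2 terms
    cancel, since -6 - 4(T - 1) + (4T + 2) = 0, so g can be divided out. N is minus the coefficient
    of g h.\<close>
  define N where "N = 2 * (3 * T * (T + 1) - 2 * M) - 2 * (4 * T + 2) - 4 * M"
  have "K * (g * ((4 * T + 2) * Y * k - N * h)) = 0"
  proof -
    have "pderiv (K * (6 * D * h\<^sup>2 + (4 * T + 2) * Y * g * h - (3 * T * (T + 1) - 2 * M) * g\<^sup>2)) = 0"
      unfolding third by (simp add: pderivs dE)
    then have "K * (- 6 * Y * h\<^sup>2 + 12 * D * h * k + (4 * T + 2) * (2 * g * h + Y * h\<^sup>2 + Y * g * k)
        - 2 * (3 * T * (T + 1) - 2 * M) * g * h) = 0"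
      by (simp add: power2_eq_square pderivs dE dD dY dM h_def[symmetric] k_def[symmetric] algebra_simps)
    moreover have "K * (g * ((4 * T + 2) * Y * k - N * h)) =
        K * (- 6 * Y * h\<^sup>2 + 12 * D * h * k + (4 * T + 2) * (2 * g * h + Y * h\<^sup>2 + Y * g * k)
        - 2 * (3 * T * (T + 1) - 2 * M) * g * h) + 4 * K * h * (g * M - L)"
      by (simp add: N_def L_def algebra_simps power2_eq_square)
    moreover have "4 * K * h * (g * M - L) = 0" using M by simp
    ultimately show ?thesis by (simp only: add_0_right)
  qed
  then have fourth: "(4 * T + 2) * Y * k = N * h" using Kne gne by simp
  define H where "H = 3 * N * D + (4 * T + 2) * (T - 1) * Y\<^sup>2"
  have "h * H = g * ((4 * T + 2) * Y * M)"
  proof -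
    have "h * H - g * ((4 * T + 2) * Y * M)
        = (4 * T + 2) * Y * (L - g * M) - 3 * D * ((4 * T + 2) * Y * k - N * h)"
      by (simp add: H_def L_def algebra_simps power2_eq_square)
    then show ?thesis using fourth M by simp
  qed
  then have "g dvd H" using cancel[of H] by (simp only: dvd_triv_left)
  moreover have "degree H \<le> 2"
  proof -
    have "degree N = 0"
      unfolding N_def by (intro const_mult const_diff) (use degT \<open>degree M = 0\<close> in auto)
    then have "degree (3 * N * D) \<le> 2"
      using degree_mult_le[of "3 * N" D] degree_mult_le[of 3 N] degD by simp
    moreover have "degree ((4 * T + 2) * (T - 1) * Y\<^sup>2) \<le> 2"
      using degree_mult_le[of "(4 * T + 2) * (T - 1)" "Y\<^sup>2"] degree_mult_le[of "4 * T + 2" "T - 1"]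
        degT degree_power_le[of Y 2] degY by simp
    ultimately show ?thesis unfolding H_def by (rule degree_add_le)
  qed
  ultimately have "H = 0" using deg dvd_imp_degree_le[of g H] by linarith
  moreover have "poly H 0 = (4 * \<tau> + 2) * (\<tau> - 1) * c\<^sup>2"
    by (simp add: H_def D_def Y_def Z_def C_def T_def)
  moreover have "2 * (2 * \<tau> + 1) \<noteq> 0" using nz by (simp only: mult_eq_0_iff simp_thms)
  then have "4 * \<tau> + 2 \<noteq> 0" by simp
  ultimately show False using nz by auto
qed

lemma card_lt_generic:
  fixes c :: "'a::field"
  assumes fin: "finite S" and t: "t \<ge> 5" and c: "c \<noteq> 0"
    and S: "\<And>x. x \<in> S \<Longrightarrow> x ^ t = 1 \<and> (c - x) ^ t = 1"
    and nz: "of_nat t \<noteq> (0::'a)" "of_nat (t + 1) \<noteq> (0::'a)" "of_nat (t - 1) \<noteq> (0::'a)"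
    "of_nat (2 * t + 1) \<noteq> (0::'a)" "(2::'a) \<noteq> 0"
  shows "2 * card S < t"
proof (rule ccontr)
  assume "\<not> 2 * card S < t"
  then have N: "t \<le> 2 * card S" by simp
  define Q where "Q = [:0, 1:] ^ (t + 1) + ([:c:] - [:0, 1:]) ^ (t + 1) - [:c:]"
  have refl: "[:c:] - [:0, 1:] = [:c, -1:]" by simp
  define g where "g = (\<Prod>s\<in>S. [:-s, 1:])"
  have dQ: "poly (pderiv Q) x = of_nat (t + 1) * (x ^ t - (c - x) ^ t)" for x
    unfolding Q_def refl Suc_eq_plus1[symmetric] pderiv_diff pderiv_add pderiv_power_of_nat
    by (simp add: pderiv_pCons algebra_simps)
  have "poly (pderiv Q) 0 \<noteq> 0" unfolding dQ using nz(2) c t by (auto simp: power_0_left)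
  then have Q0: "Q \<noteq> 0" by auto
  have "g\<^sup>2 dvd Q" unfolding g_def
  proof (rule square_prod_linear_dvd[OF fin])
    fix s assume s: "s \<in> S"
    show "poly Q s = 0" using S[OF s] by (simp add: Q_def)
    show "poly (pderiv Q) s = 0" unfolding dQ using S[OF s] by simp
  qed
  then obtain K where K: "Q = g\<^sup>2 * K" by blast
  have g0: "g \<noteq> 0" "K \<noteq> 0" using K Q0 by auto
  have degg: "degree g = card S" unfolding g_def by (rule degree_prod_linear)
  \<comment> \<open>For even t the exponent t + 1 is odd and the top terms cancel; for odd t parity
    improves t <= 2 |S| to t + 1 <= 2 |S|.\<close>
  have "degree Q \<le> 2 * card S"
  proof (cases "even t")
    case True
    have "degree Q \<le> t" unfolding Q_def refl
      using degree_sum_reflected_powers_odd[of "t + 1" c] True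
      by (intro degree_diff_le) auto
    then show ?thesis using N by simp
  next
    case False
    have "degree Q \<le> t + 1" unfolding Q_def refl
      using degree_sum_reflected_powers[of "t + 1" c]
      by (intro degree_diff_le) auto
    then show ?thesis using N False by presburger
  qed
  then have "degree K = 0"
    using g0 by (simp add: K degree_mult_eq degree_power_eq degg)
  then obtain \<kappa> where \<kappa>: "K = [:\<kappa>:]" by (rule degree_eq_zeroE)
  show False
  proof (rule no_square_of_ODE[of \<kappa> g c "of_nat t"])
    fix R assume "R = [:\<kappa>:] * g\<^sup>2"
    then have "R = Q" using K \<kappa> by (simp add: mult.commute)
    show "[:0, 1:] * ([:c:] - [:0, 1:]) * pderiv (pderiv R) + [:of_nat t:] * (2 * [:0, 1:] - [:c:]) * pderiv R =
         [:of_nat t:] * ([:of_nat t:] + 1) * (R + [:c:])"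
      unfolding \<open>R = Q\<close> of_nat_poly[symmetric]
      by (rule reflected_power_ODE) (use t in \<open>auto simp: Q_def\<close>)
  next
    show "of_nat t - 1 \<noteq> (0::'a)" using nz(3) t by (simp add: of_nat_diff)
  \<comment> \<open>From 5 <= t <= 2 |S| it follows that deg g >= 3.\<close>
  qed (use nz c t N degg g0 \<kappa> in \<open>auto simp: add.commute\<close>)
qed

section \<open>Case distinction on t modulo p\<close>

theorem theorem1p7:
  fixes p f q k t :: nat
    and A :: "'a::{field, finite} set"
  assumes "prime p"
    and "f \<ge> 1"
    and "q = p ^ f"
    and "CARD('a) = q"
    and "k dvd q - 1"
    and "A = kth_powers k"
    and "prime_field_adjoin A = UNIV"
    and "k \<ge> 3"
    and "t = card A"
    and "t \<ge> 5"
  shows "\<forall>c::'a. c \<noteq> 0 \<longrightarrow> real (sum_rep_count A c) < real t / 2"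
proof (intro allI impI)
  fix c :: 'a assume c: "c \<noteq> 0"
  have "CHAR('a) > 0" by (rule finite_imp_CHAR_pos) simp
  then have prime: "prime CHAR('a)" by (rule prime_CHAR_semidom)
  have "CHAR('a) dvd p ^ f" using CHAR_dvd_CARD[where ?'a = 'a] assms(3,4) by simp
  with prime have "CHAR('a) dvd p" by (rule prime_dvd_power)
  then have p: "CHAR('a) = p" using prime assms(1) by (simp add: primes_dvd_imp_eq)
  have q1: "k * t = q - 1" and A: "A = {x. x ^ t = 1}"
    using kth_powers_eq[OF assms(6)] assms(4,5,8,9) by auto
  have nz: "of_nat n = (0::'a) \<longleftrightarrow> p dvd n" for n
    using of_nat_eq_0_iff_char_dvd[where ?'a = 'a] p by simp
  define S where "S = {x. x ^ t = 1 \<and> (c - x) ^ t = 1}"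
  have S: "x ^ t = 1 \<and> (c - x) ^ t = 1" if "x \<in> S" for x
    using that by (simp add: S_def)
  have fin: "finite S" by simp
  have "sum_rep_count A c = card S"
    unfolding sum_rep_count_def
    by (rule bij_betw_same_card[of fst], rule bij_betwI[of _ _ _ "\<lambda>x. (x, c - x)"])
      (auto simp: A S_def algebra_simps)
  moreover have "2 * card S < t"
  proof -
    have p2: "p \<ge> 2" using assms(1) by (rule prime_ge_2_nat)
    have "p \<noteq> 4" using assms(1) by auto
    then have p235: "p = 2 \<or> p = 3 \<or> p \<ge> 5" using p2 by linarith
    have "p dvd q" using assms(2,3) by (simp add: dvd_power)
    have q0: "q > 0" using assms(3) p2 by simp
    have "\<not> p dvd k * t"
    proof
      assume "p dvd k * t"
      then have "p dvd q - 1" by (simp only: q1)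
      then have "p dvd 1" using dvd_diff_nat[OF \<open>p dvd q\<close>, of "q - 1"] q0 by simp
      then show False using p2 by simp
    qed
    then have pt: "\<not> p dvd t" by auto
    have oddt: "odd t" if "p = 2" using pt that by simp
    have cofactor: "card S \<le> m \<and> (odd m \<longrightarrow> card S \<le> m - 1)"
      if j: "j * t + 1 = p ^ e * m" "j \<le> 2" "j \<ge> 1" and m: "\<not> p dvd m" for j e m
    proof -
      have P: "p ^ e = CHAR('a) ^ e" by (simp add: p)
      have fixed: "x ^ (p ^ e * m) = x" if "x ^ t = 1" for x :: 'a
        using that by (simp flip: j(1) add: mult.commute[of j] power_add power_mult)
      \<comment> \<open>Otherwise A is fixed by x -> x^(p^e), so q <= p^e = j t + 1 and k <= j <=
        2.\<close>
      have "m \<noteq> 1"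
      proof
        assume m1: "m = 1"
        have P1: "j * t + 1 = p ^ e" using j(1) m1 by simp
        have "j * t \<ge> 1" using j assms(10) by simp
        then have "p ^ e > 1" using P1 by linarith
        then have "q \<le> p ^ e"
          using adjoin_eq_UNIV_imp_card_le[OF prime P assms(7)] fixed assms(4)
          by (simp add: A m1)
        then have "k * t \<le> j * t" using q1 P1 by simp
        then show False using j(2) assms(8,10) by simp
      qed
      moreover have "m \<noteq> 0" using m by (metis dvd_0_right)
      ultimately have "m \<ge> 2" by simp
      then show ?thesis
        using card_power_fixed_le[OF prime P _ _ c, of m S] m S fixed by (auto simp: nz)
    qed
    have split: "\<exists>e m. j * t + 1 = p ^ e * m \<and> \<not> p dvd m" for j
      using multiplicity_decompose'[of "j * t + 1" p] assms(1)
      by (metis not_prime_unit add_is_0 one_neq_zero)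
    \<comment> \<open>As p does not divide t, p = 2 forces the first case and p = 3 one of the first
      two.\<close>
    consider (minus_one) "p dvd t + 1" | (minus_half) "p dvd 2 * t + 1" "\<not> p dvd t + 1" "p \<noteq> 2"
      | (one) "p dvd t - 1" "p \<ge> 5" | (generic) "\<not> p dvd t + 1" "\<not> p dvd 2 * t + 1" "\<not> p dvd t - 1" "p \<ge> 5"
    proof -
      consider "p = 2" | "p = 3" | "p \<ge> 5" using p235 by auto
      then show thesis
      proof cases
        case 1
        then show thesis using oddt minus_one by simp
      next
        case 2
        then have "3 dvd t + 1 \<or> 3 dvd 2 * t + 1" using pt by presburger
        then show thesis using minus_one minus_half 2 by auto
      next
        case 3
        then have "p \<noteq> 2" by simp
        then show thesis using 3 minus_one minus_half one generic by blast
      qed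
    qed
    then show ?thesis
    proof cases
      case minus_one
      obtain e m where em: "t + 1 = p ^ e * m" "\<not> p dvd m" using split[of 1] by auto
      have bound: "card S \<le> m" "odd m \<Longrightarrow> card S \<le> m - 1"
        using cofactor[of 1 e m] em by auto
      have "e \<noteq> 0" using em minus_one by (metis power_0 mult_1)
      then have "p ^ 1 \<le> p ^ e" using p2 by (intro power_increasing) auto
      then have le: "p * m \<le> t + 1" using em(1) by simp
      show ?thesis
      \<comment> \<open>For p = 2 only 2m <= t + 1 is known, so the bound m - 1 for odd m is
        essential; for p >= 3 already 3m <= t + 1 suffices.\<close>
      proof (cases "p = 2")
        case True
        then have "odd m" using em(2) by simp
        then have "card S \<le> m - 1" "m > 0" using bound(2) odd_pos by auto
        moreover have "2 * m \<le> t + 1" using le True by simp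
        ultimately show ?thesis by linarith
      next
        case False
        then have "3 * m \<le> p * m" using p2 by (intro mult_right_mono) auto
        then show ?thesis using bound(1) le assms(10) by linarith
      qed
    next
      case minus_half
      obtain e m where em: "2 * t + 1 = p ^ e * m" "\<not> p dvd m" using split[of 2] by auto
      have bound: "card S \<le> m"
        using cofactor[of 2 e m] em by auto
      have "e \<noteq> 0" using em minus_half by (metis power_0 mult_1)
      show ?thesis
      \<comment> \<open>The bound |S| <= m gives the claim once p^e >= 5; for p^e = 3 it only gives
        2 |S| <= (4t + 2)/3.\<close>
      proof (cases "p = 3 \<and> e = 1")
        case True
        then have "2 * t + 1 = 3 * m" using em(1) by simp
        then have "\<exists>r. t = 1 + 3 * r \<and> m = 2 * r + 1" using assms(10) by presburger
        then obtain r where r: "t = 1 + 3 * r" "m = 2 * r + 1" by blast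
        have "of_nat (2 * r + 1) \<noteq> (0::'a)"
          using em(2) by (simp only: nz r(2)) simp
        then show ?thesis
          using True r(1) assms(10) p S fin by (intro card_lt_of_CHAR_3[OF _ r(1) c]) auto
      next
        case False
        have "5 \<le> p ^ e"
        proof (cases "p = 3")
          case True
          then have "e \<ge> 2" using False \<open>e \<noteq> 0\<close> by simp
          then have "p ^ 2 \<le> p ^ e" using p2 by (intro power_increasing) auto
          then show ?thesis using True by simp
        next
          case False
          then have "p \<ge> 5" using p235 minus_half by simp
          moreover have "p ^ 1 \<le> p ^ e" using p2 \<open>e \<noteq> 0\<close> by (intro power_increasing) auto
          ultimately show ?thesis by simp
        qed
        then have "5 * m \<le> p ^ e * m" by (intro mult_right_mono) auto
        then show ?thesis using bound em(1) assms(10) by linarith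
      qed
    next
      case one
      then obtain r where "t - 1 = p * r" by blast
      then have r: "t = 1 + CHAR('a) * r" using assms(10) p by simp
      have "r > 0" using r assms(10) by (cases r) auto
      then have "card S \<le> 2 * r"
        using card_le_of_mod_CHAR_eq_1[OF prime r c] S by blast
      \<comment> \<open>Hence 2 |S| <= 4r < 5r <= t - 1.\<close>
      moreover have "5 * r \<le> p * r" using one by (intro mult_right_mono) auto
      moreover have "t = 1 + p * r" using r p by simp
      ultimately show ?thesis using \<open>r > 0\<close> by linarith
    next
      case generic
      have "of_nat 2 \<noteq> (0::'a)" unfolding nz using generic(4) by (auto dest: dvd_imp_le)
      then have "(2::'a) \<noteq> 0" by simp
      then show ?thesis
        using generic pt by (intro card_lt_generic[OF fin assms(10) c S]) (simp_all only: nz not_False_eq_True)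
    qed
  qed
  ultimately show "real (sum_rep_count A c) < real t / 2"
    by simp
qed

end
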